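(* Let $X$ be a real Banach space, let $C$ be a nonempty weakly compact subset of $X$, and let $f : X \to \mathbb{R}$ be a function which is bounded below on $C$ and lower semi-continuous for the weak topology on $X$. For $x \in X$ put $r(x) = \sup\{\|x-z\| - f(z) : z \in C\}$. Then the set $$D(C,f) = \{x \in X : \exists z \in C,\ r(x) = \|x-z\| - f(z)\}$$ contains a dense $G_\delta$ subset of $X$ (density and $G_\delta$ being understood for the norm topology).
   Context: The set $D(C,f)$ is the set of $x \in X$ such that the function $z \mapsto \|x-z\| - f(z)$ attains its supremum on $C$. Since $C$ is bounded and $f$ is bounded below on $C$, $r$ is a real-valued function on $X$. *)

theory Defs
  imports "HOL-Analysis.Analysis"
begin

text \<open>The weak topology: the coarsest topology on the space making every continuous real-linear
  functional continuous. The norm topology is the one of the type class.\<close>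

definition weak_topology :: "'a::real_normed_vector topology" where
  "weak_topology = topology_generated_by
     {blinfun_apply \<phi> -` U | (\<phi> :: 'a \<Rightarrow>\<^sub>L real) U. open U}"

lemma topspace_weak_topology [simp]: "topspace weak_topology = UNIV"
proof -
  have "UNIV \<in> {blinfun_apply \<phi> -` U | (\<phi> :: 'a \<Rightarrow>\<^sub>L real) U. open U}"
    by (auto intro!: exI[of _ UNIV])
  then show ?thesis
    unfolding weak_topology_def topology_generated_by_topspace by blast
qed

lemma continuous_map_weak_topology_blinfun:
  fixes \<phi> :: "'a::real_normed_vector \<Rightarrow>\<^sub>L real"
  shows "continuous_map weak_topology euclideanreal (blinfun_apply \<phi>)"
  unfolding continuous_map_def
proof (intro conjI allI impI)
  fix U :: "real set" assume "openin euclideanreal U"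
  then have "blinfun_apply \<phi> -` U \<in> {blinfun_apply \<phi> -` U | (\<phi> :: 'a \<Rightarrow>\<^sub>L real) U. open U}"
    by auto
  then have "openin weak_topology (blinfun_apply \<phi> -` U)"
    unfolding weak_topology_def by (rule topology_generated_by_Basis)
  then show "openin weak_topology {x \<in> topspace weak_topology. blinfun_apply \<phi> x \<in> U}"
    by (simp add: vimage_def)
qed simp

definition lower_semicontinuous_map :: "'a topology \<Rightarrow> ('a \<Rightarrow> real) \<Rightarrow> bool" where
  "lower_semicontinuous_map T f \<longleftrightarrow> (\<forall>a. openin T {x \<in> topspace T. a < f x})"

text \<open>The supremum below is the one of the reals, which is meaningful only for nonempty sets that
  are bounded above. This is the case when C is nonempty and bounded (as every weakly compact
  set is) and f is bounded below on C.\<close>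

definition farthest_sup :: "'a::real_normed_vector set \<Rightarrow> ('a \<Rightarrow> real) \<Rightarrow> 'a \<Rightarrow> real" where
  "farthest_sup C f x = (SUP z\<in>C. norm (x - z) - f z)"

definition farthest_attained :: "'a::real_normed_vector set \<Rightarrow> ('a \<Rightarrow> real) \<Rightarrow> 'a set" where
  "farthest_attained C f = {x. \<exists>z\<in>C. farthest_sup C f x = norm (x - z) - f z}"

end

theory Submission
  imports Defs
begin

text \<open>
  The function r is convex and 1-Lipschitz, so at each x it has subgradients, all of norm at most 1.
  If a subgradient \<open>\<phi>\<close> at x satisfies \<open>sup {\<phi> (x - z) - f z | z \<in> C} = r x\<close>, then x is in D(C,f):
  by weak compactness that supremum is attained at some z in C, and
  \<open>\<phi> (x - z) \<le> \<parallel>x - z\<parallel>\<close>. The points having a subgradient for which this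
  supremum falls short of r x by at least \<open>\<delta>\<close> form a nowhere dense set: push a point y away from an
  almost farthest z in C to a point u. Then r grows from y to u at nearly unit rate in the direction
  u - z, while a gap \<open>\<delta>\<close> at or near u would force a smaller slope there, against
  convexity. Baire's theorem, applied with \<open>\<delta> = 1/n\<close>, finishes the proof (Lau's argument).
\<close>

section \<open>Sublinear functionals and subgradients\<close>

text \<open>Homogeneity is required only as an inequality, which is easier to check for infima;
  applying it with \<open>inverse t\<close> recovers equality.\<close>

definition sublinear :: "('a::real_vector \<Rightarrow> real) \<Rightarrow> bool" where
  "sublinear q \<longleftrightarrow> (\<forall>v w. q (v + w) \<le> q v + q w) \<and> (\<forall>t>0. \<forall>v. q (t *\<^sub>R v) \<le> t * q v)"

lemma sublinear_add: "sublinear q \<Longrightarrow> q (v + w) \<le> q v + q w"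
  by (simp add: sublinear_def)

lemma sublinear_scaleR_le: "sublinear q \<Longrightarrow> 0 < t \<Longrightarrow> q (t *\<^sub>R v) \<le> t * q v"
  by (simp add: sublinear_def)

lemma sublinear_scaleR:
  assumes "sublinear q" and "0 < t"
  shows "q (t *\<^sub>R v) = t * q v"
proof (rule antisym)
  have "q (inverse t *\<^sub>R t *\<^sub>R v) \<le> inverse t * q (t *\<^sub>R v)"
    using assms by (intro sublinear_scaleR_le) auto
  then show "t * q v \<le> q (t *\<^sub>R v)"
    using \<open>0 < t\<close> by (simp add: field_simps)
qed (rule sublinear_scaleR_le[OF assms])

lemma sublinear_zero: "sublinear q \<Longrightarrow> q 0 = 0"
  using sublinear_scaleR[of q 2 0] by simp

text \<open>The condition on sums is a form of downward directedness: one index \<open>k\<close>,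
  which may depend on \<open>v\<close> and \<open>w\<close>, must serve two values with different
  indices. The infima taken below, over translates, chains and difference quotients, all fit this
  pattern.\<close>

lemma sublinear_INF:
  fixes g :: "'i \<Rightarrow> 'a::real_vector \<Rightarrow> real"
  assumes "I \<noteq> {}" and bdd: "\<And>v. bdd_below ((\<lambda>i. g i v) ` I)"
    and add: "\<And>i j v w. i \<in> I \<Longrightarrow> j \<in> I \<Longrightarrow> \<exists>k\<in>I. g k (v + w) \<le> g i v + g j w"
    and scale: "\<And>i t v. i \<in> I \<Longrightarrow> 0 < t \<Longrightarrow> \<exists>k\<in>I. g k (t *\<^sub>R v) \<le> t * g i v"
  shows "sublinear (\<lambda>v. INF i\<in>I. g i v)"
proof -
  have lower: "(INF i\<in>I. g i v) \<le> a" if "k \<in> I" "g k v \<le> a" for k v a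
    using cINF_lower[OF bdd that(1), of v] that(2) by linarith
  have "(INF i\<in>I. g i (v + w)) \<le> (INF i\<in>I. g i v) + (INF i\<in>I. g i w)" for v w
  proof -
    have *: "(INF i\<in>I. g i (v + w)) \<le> g i v + g j w" if "i \<in> I" "j \<in> I" for i j
      using add[OF that] lower by blast
    have "(INF i\<in>I. g i (v + w)) - (INF i\<in>I. g i w) \<le> g i v" if "i \<in> I" for i
    proof -
      have "(INF i\<in>I. g i (v + w)) - g i v \<le> (INF i\<in>I. g i w)"
        using *[OF that] by (intro cINF_greatest[OF \<open>I \<noteq> {}\<close>]) (simp add: algebra_simps)
      then show ?thesis by simp
    qed
    then have "(INF i\<in>I. g i (v + w)) - (INF i\<in>I. g i w) \<le> (INF i\<in>I. g i v)"
      by (intro cINF_greatest[OF \<open>I \<noteq> {}\<close>])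
    then show ?thesis by simp
  qed
  moreover have "(INF i\<in>I. g i (t *\<^sub>R v)) \<le> t * (INF i\<in>I. g i v)" if "0 < t" for t v
  proof -
    have "(INF i\<in>I. g i (t *\<^sub>R v)) / t \<le> (INF i\<in>I. g i v)"
    proof (rule cINF_greatest[OF \<open>I \<noteq> {}\<close>])
      fix i assume "i \<in> I"
      then show "(INF i\<in>I. g i (t *\<^sub>R v)) / t \<le> g i v"
        using scale[OF _ that] lower that by (metis mult.commute pos_divide_le_eq)
    qed
    then show ?thesis
      using that by (simp add: field_simps)
  qed
  ultimately show ?thesis
    by (simp add: sublinear_def)
qed

text \<open>Compare q with the infimum over t \<open>\<ge>\<close> 0 of \<open>q (v + t a) - t q a\<close>, which is sublinear
  and below q.\<close>

lemma minimal_sublinear_additive: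
  assumes q: "sublinear q" and min: "\<And>q'. sublinear q' \<Longrightarrow> q' \<le> q \<Longrightarrow> q' = q"
  shows "q (v + a) = q v + q a"
proof -
  define g where "g = (\<lambda>t v. q (v + t *\<^sub>R a) - t * q a)"
  \<comment> \<open>For positive \<open>t\<close>, \<open>t * q a\<close> is
    \<open>q (t *\<^sub>R a)\<close>, and t a is the sum of v + t a and - v. The bound is
    independent of \<open>t\<close>, so the infimum is a genuine one.\<close>
  have ge: "- q (- v) \<le> g t v" if "t \<in> {0..}" for t v
  proof (cases "t = 0")
    case True
    then show ?thesis
      using sublinear_add[OF q, of v "- v"] sublinear_zero[OF q] by (simp add: g_def)
  next
    case False
    then have "q (t *\<^sub>R a) = t * q a"
      using q that by (intro sublinear_scaleR) auto
    then show ?thesis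
      using sublinear_add[OF q, of "v + t *\<^sub>R a" "- v"] by (simp add: g_def)
  qed
  then have bdd: "bdd_below ((\<lambda>t. g t v) ` {0..})" for v
    by (meson bdd_belowI2)
  have "sublinear (\<lambda>v. INF t\<in>{0..}. g t v)"
  proof (rule sublinear_INF[OF _ bdd])
    fix s t :: real and v w
    assume "s \<in> {0..}" "t \<in> {0..}"
    moreover have "g (s + t) (v + w) \<le> g s v + g t w"
      using sublinear_add[OF q, of "v + s *\<^sub>R a" "w + t *\<^sub>R a"]
      by (simp add: g_def algebra_simps)
    ultimately show "\<exists>k\<in>{0..}. g k (v + w) \<le> g s v + g t w"
      by (intro bexI[of _ "s + t"]) auto
  next
    fix s t :: real and v
    assume "s \<in> {0..}" "0 < t"
    moreover from \<open>0 < t\<close> have "g (t * s) (t *\<^sub>R v) = t * g s v"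
      using sublinear_scaleR[OF q, of t "v + s *\<^sub>R a"] by (simp add: g_def algebra_simps)
    ultimately show "\<exists>k\<in>{0..}. g k (t *\<^sub>R v) \<le> t * g s v"
      by (intro bexI[of _ "t * s"]) auto
  qed auto
  moreover have "(\<lambda>v. INF t\<in>{0..}. g t v) \<le> q"
  proof (rule le_funI)
    fix v
    show "(INF t\<in>{0..}. g t v) \<le> q v"
      using cINF_lower[OF bdd, of 0 v] by (simp add: g_def)
  qed
  ultimately have "(INF t\<in>{0..}. g t v) = q v"
    using min by (metis (no_types, lifting))
  \<comment> \<open>By minimality \<open>q\<close> equals the infimum; its term at t = 1 yields the
    converse of subadditivity.\<close>
  then have "q v \<le> g 1 v"
    using cINF_lower[OF bdd, of 1 v] by simp
  then show ?thesis
    using sublinear_add[OF q, of v a] by (simp add: g_def)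
qed

text \<open>Zorn's lemma provides a minimal sublinear functional below \<open>p\<close>. Minimality
  makes it additive, and additivity with positive homogeneity makes it linear.\<close>

theorem Hahn_Banach_sublinear:
  assumes p: "sublinear p"
  shows "\<exists>h. linear h \<and> (\<forall>v. h v \<le> p v)"
proof -
  define A where "A = {q. sublinear q \<and> q \<le> p}"
  have "\<exists>m\<in>A. \<forall>q\<in>A. q \<le> m \<longrightarrow> q = m"
  \<comment> \<open>The order is reversed, so that the maximal element of Zorn's lemma is a minimal
    functional.\<close>
  proof (rule predicate_Zorn)
    show "partial_order_on A (relation_of (\<lambda>a b. b \<le> a) A)"
      by (rule partial_order_on_relation_ofI) auto
    fix C assume C: "C \<in> Chains (relation_of (\<lambda>a b. b \<le> a) A)"
    then have "C \<subseteq> A" by (rule Chains_relation_of)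
    have total: "c \<le> d \<or> d \<le> c" if "c \<in> C" "d \<in> C" for c d
      using C that by (auto simp: Chains_def relation_of_def)
    show "\<exists>u\<in>A. \<forall>a\<in>C. u \<le> a"
    proof (cases "C = {}")
      case True
      then show ?thesis using p by (auto simp: A_def)
    next
      case False
      have sub: "sublinear c" "c \<le> p" if "c \<in> C" for c
        using that \<open>C \<subseteq> A\<close> by (auto simp: A_def)
      \<comment> \<open>From 0 = c 0 \<le> c v + c (- v) and c \<le> p: a bound common to the whole
        chain.\<close>
      have "- p (- v) \<le> c v" if "c \<in> C" for c v
        using sublinear_add[OF sub(1)[OF that], of v "- v"] sublinear_zero[OF sub(1)[OF that]]
          le_funD[OF sub(2)[OF that], of "- v"] by simp
      then have bdd: "bdd_below ((\<lambda>c. c v) ` C)" for v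
        by (meson bdd_belowI2)
      have "sublinear (\<lambda>v. INF c\<in>C. c v)"
      proof (rule sublinear_INF[OF False bdd])
        fix c d v w assume cd: "c \<in> C" "d \<in> C"
        \<comment> \<open>The smaller of the two comparable functionals serves as
          \<open>k\<close>.\<close>
        show "\<exists>k\<in>C. k (v + w) \<le> c v + d w"
          using total[OF cd]
        proof
          assume "c \<le> d"
          then have "c (v + w) \<le> c v + d w"
            using sublinear_add[OF sub(1)[OF cd(1)], of v w] le_funD[of c d w] by linarith
          then show ?thesis using cd by blast
        next
          assume "d \<le> c"
          then have "d (v + w) \<le> c v + d w"
            using sublinear_add[OF sub(1)[OF cd(2)], of v w] le_funD[of d c v] by linarith
          then show ?thesis using cd by blast
        qed
      qed (use sub sublinear_scaleR_le in blast)
      moreover have lower: "(\<lambda>v. INF c\<in>C. c v) \<le> c" if "c \<in> C" for c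
        by (rule le_funI) (rule cINF_lower[OF bdd that])
      moreover have "(\<lambda>v. INF c\<in>C. c v) \<le> p"
        using False lower sub(2) by (meson ex_in_conv order_trans)
      ultimately show ?thesis
        by (intro bexI[of _ "\<lambda>v. INF c\<in>C. c v"]) (auto simp: A_def)
    qed
  qed
  then obtain m where m: "sublinear m" "m \<le> p"
    and min: "\<And>q. sublinear q \<Longrightarrow> q \<le> m \<Longrightarrow> q = m"
    by (auto simp: A_def)
  have add: "m (v + w) = m v + m w" for v w
    using minimal_sublinear_additive[OF m(1) min] .
  have neg: "m (- v) = - m v" for v
    using add[of v "- v"] sublinear_zero[OF m(1)] by simp
  have "linear m"
  proof (rule linearI)
    fix t :: real and v
    consider "t = 0" | "0 < t" | "t < 0" by linarith
    then show "m (t *\<^sub>R v) = t *\<^sub>R m v"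
    proof cases
      case 3
      then have "m ((- t) *\<^sub>R v) = - t * m v"
        by (intro sublinear_scaleR[OF m(1)]) auto
      then show ?thesis using neg[of "t *\<^sub>R v"] by simp
    qed (auto simp: sublinear_zero[OF m(1)] sublinear_scaleR[OF m(1)])
  qed (rule add)
  then show ?thesis
    using m(2) by (auto simp: le_fun_def)
qed

text \<open>Convexity makes the directional derivative at \<open>x\<close> sublinear, so Hahn-Banach
  puts a linear \<open>h\<close> below it. The difference quotient at t = 1 gives the subgradient
  inequality; combined with the Lipschitz bound for \<open>v\<close> and \<open>- v\<close>, it also
  bounds the norm of \<open>h\<close>.\<close>

lemma convex_lipschitz_subgradient:
  fixes r :: "'a::real_normed_vector \<Rightarrow> real"
  assumes conv: "convex_on UNIV r" and lip: "L-lipschitz_on UNIV r"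
  shows "\<exists>\<phi>::'a \<Rightarrow>\<^sub>L real. norm \<phi> \<le> L \<and> (\<forall>y. r x + blinfun_apply \<phi> (y - x) \<le> r y)"
proof -
  have "0 \<le> L" using lip by (rule lipschitz_on_nonneg)
  have lip': "\<bar>r y - r z\<bar> \<le> L * norm (y - z)" for y z
    using lipschitz_on_normD[OF lip, of y z] by simp
  \<comment> \<open>The infimum over t > 0 of these quotients is the directional derivative of r at x.\<close>
  define g where "g = (\<lambda>t v. (r (x + t *\<^sub>R v) - r x) / t)"
  have ge: "- (L * norm v) \<le> g t v" if "t \<in> {0<..}" for t v
    using lip'[of "x + t *\<^sub>R v" x] that by (simp add: g_def field_simps)
  then have bdd: "bdd_below ((\<lambda>t. g t v) ` {0<..})" for v
    by (meson bdd_belowI2)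
  have "sublinear (\<lambda>v. INF t\<in>{0<..}. g t v)"
  proof (rule sublinear_INF[OF _ bdd])
    fix s t :: real and v w
    assume "s \<in> {0<..}" "t \<in> {0<..}"
    then have st: "0 < s" "0 < t" by auto
    \<comment> \<open>The weights balance the two step lengths: since \<open>a * s\<close> and
      \<open>b * t\<close> both equal \<open>u\<close>, the convex combination of x + s v and x + t
      w is x + u (v + w).\<close>
    define a b u where "a = t / (s + t)" and "b = s / (s + t)" and "u = s * t / (s + t)"
    have ab: "0 \<le> a" "0 \<le> b" "a + b = 1" "a * s = u" "b * t = u" "0 < u"
      using st by (auto simp: a_def b_def u_def simp flip: add_divide_distrib)
    have "a *\<^sub>R (x + s *\<^sub>R v) + b *\<^sub>R (x + t *\<^sub>R w) = (a + b) *\<^sub>R x + (a * s) *\<^sub>R v + (b * t) *\<^sub>R w"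
      by (simp add: algebra_simps)
    also have "\<dots> = x + u *\<^sub>R (v + w)"
      using ab by (simp add: algebra_simps)
    finally have "r (x + u *\<^sub>R (v + w)) \<le> a * r (x + s *\<^sub>R v) + b * r (x + t *\<^sub>R w)"
      using conv ab unfolding convex_on_def by (metis UNIV_I)
    also have "\<dots> = r x + a * (r (x + s *\<^sub>R v) - r x) + b * (r (x + t *\<^sub>R w) - r x)"
      using ab(3) by (simp add: algebra_simps) (metis distrib_right mult_1)
    also have "\<dots> = r x + u * (g s v + g t w)"
    proof -
      have "a * (r (x + s *\<^sub>R v) - r x) = u * g s v"
        using st by (simp add: g_def flip: ab(4))
      moreover have "b * (r (x + t *\<^sub>R w) - r x) = u * g t w"
        using st by (simp add: g_def flip: ab(5))
      ultimately show ?thesis by (simp add: distrib_left)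
    qed
    finally have "g u (v + w) \<le> g s v + g t w"
      using \<open>0 < u\<close> by (simp add: g_def field_simps)
    with \<open>0 < u\<close> show "\<exists>k\<in>{0<..}. g k (v + w) \<le> g s v + g t w"
      by auto
  next
    fix s t :: real and v
    assume "s \<in> {0<..}" "0 < t"
    \<comment> \<open>Step s / t in direction t v reaches the same point as step s in direction
      v.\<close>
    then have "g (s / t) (t *\<^sub>R v) \<le> t * g s v" "s / t \<in> {0<..}"
      by (auto simp: g_def mult.commute)
    then show "\<exists>k\<in>{0<..}. g k (t *\<^sub>R v) \<le> t * g s v" by blast
  qed auto
  from Hahn_Banach_sublinear[OF this] obtain h where "linear h"
    and h: "\<And>v. h v \<le> (INF t\<in>{0<..}. g t v)" by blast
  have h1: "h v \<le> r (x + v) - r x" for v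
    using h[of v] cINF_lower[OF bdd, of 1 v] by (simp add: g_def)
  have "\<bar>h v\<bar> \<le> L * norm v" for v
    using h1[of v] h1[of "- v"] lip'[of "x + v" x] lip'[of "x - v" x]
      linear_neg[OF \<open>linear h\<close>, of v] by simp
  then have bound: "norm (h v) \<le> norm v * L" for v
    by (simp add: mult.commute)
  interpret linear h by fact
  have bl: "bounded_linear h"
    using bound by unfold_locales blast
  show ?thesis
  proof (intro exI conjI allI)
    show "norm (Blinfun h) \<le> L"
      using bound \<open>0 \<le> L\<close>
      by (intro norm_blinfun_bound) (auto simp: bounded_linear_Blinfun_apply[OF bl] mult.commute)
    show "r x + Blinfun h (y - x) \<le> r y" for y
      using h1[of "y - x"] by (simp add: bounded_linear_Blinfun_apply[OF bl])
  qed
qed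

text \<open>Any subgradient of the norm at \<open>x\<close> will do: its inequality at the origin
  reads norm x \<le> \<phi> x.\<close>

lemma norming_functional:
  fixes x :: "'a::real_normed_vector"
  shows "\<exists>\<phi>::'a \<Rightarrow>\<^sub>L real. norm \<phi> \<le> 1 \<and> blinfun_apply \<phi> x = norm x"
proof -
  have "convex_on UNIV (norm :: 'a \<Rightarrow> real)"
    using convex_on_dist[of UNIV "0::'a"] by simp
  moreover have "1-lipschitz_on UNIV (norm :: 'a \<Rightarrow> real)"
    by (rule lipschitz_onI) (auto simp: dist_norm norm_triangle_ineq3)
  ultimately obtain \<phi> :: "'a \<Rightarrow>\<^sub>L real" where "norm \<phi> \<le> 1"
    and \<phi>: "\<And>y. norm x + blinfun_apply \<phi> (y - x) \<le> norm y"
    using convex_lipschitz_subgradient by blast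
  then have "blinfun_apply \<phi> x \<le> norm x"
    using norm_blinfun[of \<phi> x] mult_right_mono[of "norm \<phi>" 1 "norm x"] by simp
  with \<open>norm \<phi> \<le> 1\<close> \<phi>[of 0] show ?thesis
    by (auto simp: blinfun.minus_right intro!: exI[of _ \<phi>])
qed

section \<open>Weakly compact sets\<close>

text \<open>Banach--Steinhaus: Baire's theorem in the dual space.\<close>

lemma weakly_compact_imp_bounded:
  fixes C :: "'a::real_normed_vector set"
  assumes C: "compactin weak_topology C"
  shows "bounded C"
proof -
  define K where "K = (\<lambda>n::nat. {\<phi>::'a \<Rightarrow>\<^sub>L real. \<forall>z\<in>C. \<bar>blinfun_apply \<phi> z\<bar> \<le> real n})"
  have "closed (K n)" for n
  proof -
    have "K n = (\<Inter>z\<in>C. {\<phi>. \<bar>blinfun_apply \<phi> z\<bar> \<le> real n})"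
      by (auto simp: K_def)
    then show ?thesis
      by (auto intro!: closed_INT closed_Collect_le continuous_intros)
  qed
  moreover have "(\<Union>n. K n) = UNIV"
  proof -
    have "\<exists>n. \<phi> \<in> K n" for \<phi>
    proof -
      have "compact (blinfun_apply \<phi> ` C)"
        using image_compactin[OF C continuous_map_weak_topology_blinfun] by simp
      then obtain b where b: "\<And>z. z \<in> C \<Longrightarrow> \<bar>blinfun_apply \<phi> z\<bar> \<le> b"
        using compact_imp_bounded by (force simp: bounded_iff)
      obtain n where "b \<le> real n" using real_arch_simple by blast
      with b have "\<phi> \<in> K n" by (force simp: K_def)
      then show ?thesis ..
    qed
    then show ?thesis by blast
  qed
  \<comment> \<open>Otherwise the complete dual space would be a countable union of closed sets with
    empty interior.\<close>
  ultimately obtain n where "interior (K n) \<noteq> {}"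
    using Baire_category_alt[of "euclidean :: ('a \<Rightarrow>\<^sub>L real) topology" "range K"]
      completely_metrizable_space_euclidean
    by (auto simp: closed_closedin[symmetric])
  then obtain \<phi> e where "0 < e" and ball: "cball \<phi> e \<subseteq> K n"
    by (meson ex_in_conv mem_interior_cball)
  have "norm z \<le> 2 * real n / e" if "z \<in> C" for z
  proof -
    obtain \<psi> :: "'a \<Rightarrow>\<^sub>L real" where \<psi>: "norm \<psi> \<le> 1" "blinfun_apply \<psi> z = norm z"
      using norming_functional by blast
    \<comment> \<open>The values of these two functionals at \<open>z\<close> differ by
      \<open>e * norm z\<close> and both lie within \<open>n\<close> of 0, where \<open>n\<close>
      and \<open>e\<close> do not depend on \<open>z\<close>.\<close>
    have "\<phi> \<in> K n" "\<phi> + e *\<^sub>R \<psi> \<in> K n"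
      using ball \<open>0 < e\<close> \<psi>(1) by (auto simp: subset_iff dist_norm)
    then have "\<bar>blinfun_apply \<phi> z\<bar> \<le> n" "\<bar>blinfun_apply \<phi> z + e * norm z\<bar> \<le> n"
      using that \<psi>(2) by (auto simp: K_def blinfun.add_left blinfun.scaleR_left)
    then show ?thesis
      using \<open>0 < e\<close> by (simp add: field_simps)
  qed
  then show ?thesis
    by (auto simp: bounded_iff)
qed

section \<open>Lower semi-continuous functions on compact sets\<close>

lemma lower_semicontinuous_map_add_continuous_map:
  assumes f: "lower_semicontinuous_map T f" and h: "continuous_map T euclideanreal h"
  shows "lower_semicontinuous_map T (\<lambda>x. h x + f x)"
  unfolding lower_semicontinuous_map_def
proof
  fix a
  \<comment> \<open>A level \<open>q\<close> strictly between \<open>a - h x\<close> and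
    \<open>f x\<close> separates the conditions on \<open>h\<close> and \<open>f\<close>.\<close>
  have "{x \<in> topspace T. a < h x + f x}
      = (\<Union>q. {x \<in> topspace T. h x \<in> {a - q<..}} \<inter> {x \<in> topspace T. q < f x})"
  proof safe
    fix x assume x: "x \<in> topspace T" "a < h x + f x"
    then obtain q where "a - h x < q" "q < f x"
      using dense[of "a - h x" "f x"] by (auto simp: algebra_simps)
    with x show "x \<in> (\<Union>q. {x \<in> topspace T. h x \<in> {a - q<..}} \<inter> {x \<in> topspace T. q < f x})"
      by (auto intro!: exI[of _ q])
  qed auto
  moreover have "openin T \<dots>"
    using f openin_continuous_map_preimage[OF h]
    by (intro openin_Union) (auto simp: lower_semicontinuous_map_def simp del: greaterThan_iff)
  ultimately show "openin T {x \<in> topspace T. a < h x + f x}" by simp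
qed

text \<open>Without a minimum, the open sets where \<open>g\<close> exceeds \<open>g w\<close>, for
  \<open>w\<close> in \<open>C\<close>, would cover \<open>C\<close>. In a finite subcover, a
  minimizer of \<open>g\<close> among the finitely many indices would remain uncovered.\<close>

lemma lower_semicontinuous_map_attains_min:
  assumes g: "lower_semicontinuous_map T g" and C: "compactin T C" "C \<noteq> {}"
  shows "\<exists>z\<in>C. \<forall>w\<in>C. g z \<le> g w"
proof (rule ccontr)
  assume "\<not> ?thesis"
  then have "\<forall>z\<in>C. \<exists>w\<in>C. g w < g z" by (force simp: not_le)
  define U where "U = (\<lambda>w. {x \<in> topspace T. g w < g x})"
  have "C \<subseteq> topspace T" using C(1) by (rule compactin_subset_topspace)
  have "\<forall>V\<in>U ` C. openin T V"
    using g by (auto simp: U_def lower_semicontinuous_map_def)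
  moreover have "C \<subseteq> \<Union> (U ` C)"
    using \<open>C \<subseteq> topspace T\<close> \<open>\<forall>z\<in>C. \<exists>w\<in>C. g w < g z\<close> by (fastforce simp: U_def)
  ultimately obtain F where "finite F" "F \<subseteq> U ` C" "C \<subseteq> \<Union>F"
    using C(1) unfolding compactin_def by meson
  then obtain W where W: "finite W" "W \<subseteq> C" "C \<subseteq> \<Union> (U ` W)"
    by (metis finite_subset_image)
  then have "W \<noteq> {}" using C(2) by auto
  define w where "w = arg_min_on g W"
  have "w \<in> W" and w: "\<And>v. v \<in> W \<Longrightarrow> g w \<le> g v"
    using W(1) \<open>W \<noteq> {}\<close> unfolding w_def
    by (auto intro: arg_min_if_finite(1) arg_min_least)
  then show False
    using W by (force simp: U_def)
qed


section \<open>Farthest points\<close>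

lemma farthest_sup_upper:
  assumes "bounded C" and "bdd_below (f ` C)" and "z \<in> C"
  shows "norm (x - z) - f z \<le> farthest_sup C f x"
  unfolding farthest_sup_def
proof (rule cSUP_upper[OF \<open>z \<in> C\<close>])
  obtain b where b: "\<And>z. z \<in> C \<Longrightarrow> norm z \<le> b"
    using \<open>bounded C\<close> by (auto simp: bounded_iff)
  obtain m where m: "\<And>z. z \<in> C \<Longrightarrow> m \<le> f z"
    using \<open>bdd_below (f ` C)\<close> by (auto simp: bdd_below_def)
  have "norm (x - z) - f z \<le> norm x + b - m" if "z \<in> C" for z
    using b[OF that] m[OF that] norm_triangle_ineq4[of x z] by linarith
  then show "bdd_above ((\<lambda>z. norm (x - z) - f z) ` C)"
    by (rule bdd_aboveI2)
qed

lemma farthest_sup_least: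
  assumes "C \<noteq> {}" and "\<And>z. z \<in> C \<Longrightarrow> norm (x - z) - f z \<le> a"
  shows "farthest_sup C f x \<le> a"
  unfolding farthest_sup_def using assms by (rule cSUP_least)

lemma lipschitz_farthest_sup:
  assumes "C \<noteq> {}" and "bounded C" and "bdd_below (f ` C)"
  shows "1-lipschitz_on UNIV (farthest_sup C f)"
proof (rule lipschitz_onI)
  have le: "farthest_sup C f x \<le> farthest_sup C f y + norm (x - y)" for x y
  proof (rule farthest_sup_least[OF \<open>C \<noteq> {}\<close>])
    fix z assume "z \<in> C"
    then show "norm (x - z) - f z \<le> farthest_sup C f y + norm (x - y)"
      using farthest_sup_upper[OF assms(2,3), of z y] norm_triangle_ineq[of "x - y" "y - z"] by simp
  qed
  show "dist (farthest_sup C f x) (farthest_sup C f y) \<le> 1 * dist x y" for x y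
    using le[of x y] le[of y x] by (simp add: dist_norm norm_minus_commute abs_le_iff)
qed simp

lemma convex_farthest_sup:
  assumes "C \<noteq> {}" and "bounded C" and "bdd_below (f ` C)"
  shows "convex_on UNIV (farthest_sup C f)"
proof (rule convex_onI)
  fix t :: real and x y
  assume t: "0 < t" "t < 1"
  show "farthest_sup C f ((1 - t) *\<^sub>R x + t *\<^sub>R y)
      \<le> (1 - t) * farthest_sup C f x + t * farthest_sup C f y"
  proof (rule farthest_sup_least[OF \<open>C \<noteq> {}\<close>])
    fix z assume "z \<in> C"
    note upper = farthest_sup_upper[OF assms(2,3) this]
    have "(1 - t) *\<^sub>R x + t *\<^sub>R y - z = (1 - t) *\<^sub>R (x - z) + t *\<^sub>R (y - z)"
      by (simp add: algebra_simps)
    then have "norm ((1 - t) *\<^sub>R x + t *\<^sub>R y - z) \<le> (1 - t) * norm (x - z) + t * norm (y - z)"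
      using norm_triangle_ineq[of "(1 - t) *\<^sub>R (x - z)" "t *\<^sub>R (y - z)"] t by simp
    moreover have "(1 - t) * (norm (x - z) - f z) \<le> (1 - t) * farthest_sup C f x"
      "t * (norm (y - z) - f z) \<le> t * farthest_sup C f y"
      using upper t by (auto intro: mult_left_mono)
    ultimately show "norm ((1 - t) *\<^sub>R x + t *\<^sub>R y - z) - f z
        \<le> (1 - t) * farthest_sup C f x + t * farthest_sup C f y"
      by (simp add: algebra_simps)
  qed
qed simp

section \<open>Points with a subgradient gap\<close>

definition subgradient_gap :: "'a::real_normed_vector set \<Rightarrow> ('a \<Rightarrow> real) \<Rightarrow> real \<Rightarrow> 'a set" where
  "subgradient_gap C f \<delta> =
    {x. \<exists>\<phi>::'a \<Rightarrow>\<^sub>L real. norm \<phi> \<le> 1 \<and>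
      (\<forall>y. farthest_sup C f x + blinfun_apply \<phi> (y - x) \<le> farthest_sup C f y) \<and>
      (\<forall>z\<in>C. blinfun_apply \<phi> (x - z) - f z \<le> farthest_sup C f x - \<delta>)}"

lemma nowhere_dense_subgradient_gap:
  assumes C: "C \<noteq> {}" "bounded C" "bdd_below (f ` C)" and "0 < \<delta>"
  shows "interior (closure (subgradient_gap C f \<delta>)) = {}"
proof (rule ccontr)
  let ?r = "farthest_sup C f"
  assume "interior (closure (subgradient_gap C f \<delta>)) \<noteq> {}"
  then obtain y e where "0 < e" and ball: "ball y e \<subseteq> closure (subgradient_gap C f \<delta>)"
    by (meson ex_in_conv mem_interior)
  obtain b where "0 < b" and b: "\<And>z. z \<in> C \<Longrightarrow> norm (y - z) \<le> b"
  proof -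
    obtain b where b: "\<And>z. z \<in> C \<Longrightarrow> norm z \<le> b"
      using \<open>bounded C\<close> by (auto simp: bounded_iff)
    then have "norm (y - z) \<le> norm y + b" if "z \<in> C" for z
      using norm_triangle_ineq4[of y z] b[OF that] by linarith
    then show ?thesis
      by (intro that[of "max 1 (norm y + b)"]) (auto intro: max.coboundedI2)
  qed
  \<comment> \<open>Since \<open>b\<close> bounds \<open>norm (y - z)\<close> for every
    \<open>z\<close> in \<open>C\<close>, \<open>l\<close> can be fixed before \<open>z\<close> is
    chosen; \<open>l * b = e / 2\<close> keeps \<open>u\<close> in the ball.\<close>
  define l where "l = e / (2 * b)"
  have "0 < l" using \<open>0 < e\<close> \<open>0 < b\<close> by (simp add: l_def)
  \<comment> \<open>The tolerance for the almost farthest \<open>z\<close>. Extending y - z by the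
    factor 1 + l magnifies it to l \<delta> / 2, half of what the gap contributes.\<close>
  define \<theta> where "\<theta> = l * \<delta> / 2 / (1 + l)"
  have "0 < \<theta>"
    using \<open>0 < l\<close> \<open>0 < \<delta>\<close> by (simp add: \<theta>_def)
  have \<theta>: "(1 + l) * \<theta> = l * \<delta> / 2"
    unfolding \<theta>_def times_divide_eq_right[of "1 + l" _ "1 + l"]
    using \<open>0 < l\<close> by (intro nonzero_mult_div_cancel_left) simp
  obtain z where "z \<in> C" and z: "?r y - \<theta> < norm (y - z) - f z"
    using farthest_sup_least[OF \<open>C \<noteq> {}\<close>, of y f "?r y - \<theta>"] \<open>0 < \<theta>\<close> by force
  define u where "u = y + l *\<^sub>R (y - z)"
  have "norm (u - y) \<le> l * b"
    using b[OF \<open>z \<in> C\<close>] \<open>0 < l\<close> by (simp add: u_def)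
  also have "\<dots> < e" using \<open>0 < e\<close> \<open>0 < b\<close> by (simp add: l_def)
  finally have "u \<in> closure (subgradient_gap C f \<delta>)"
    using ball by (auto simp: subset_iff dist_norm norm_minus_commute)
  \<comment> \<open>Only the closure of the gap set is known to contain \<open>u\<close>. The error
    l \<delta> / 4 of passing to \<open>x\<close> enters twice: through \<open>a\<close>, and
    through comparing r at \<open>u\<close> and \<open>x\<close>.\<close>
  then obtain x where "x \<in> subgradient_gap C f \<delta>" and "dist x u < l * \<delta> / 4"
    using \<open>0 < l\<close> \<open>0 < \<delta>\<close> unfolding closure_approachable by (meson divide_pos_pos mult_pos_pos zero_less_numeral)
  then have xu: "norm (u - x) \<le> l * \<delta> / 4"
    by (simp add: dist_norm norm_minus_commute)
  obtain \<phi> :: "'a \<Rightarrow>\<^sub>L real" where "norm \<phi> \<le> 1"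
    and sub: "?r x + blinfun_apply \<phi> (y - x) \<le> ?r y"
    and gap: "blinfun_apply \<phi> (x - z) - f z \<le> ?r x - \<delta>"
    using \<open>x \<in> subgradient_gap C f \<delta>\<close> \<open>z \<in> C\<close> unfolding subgradient_gap_def by blast
  define p where "p = blinfun_apply \<phi> (y - z)"
  define a where "a = blinfun_apply \<phi> (u - x)"
  have "\<bar>a\<bar> \<le> norm (u - x)"
    using norm_blinfun[of \<phi> "u - x"] mult_right_mono[OF \<open>norm \<phi> \<le> 1\<close>, of "norm (u - x)"]
    by (simp add: a_def)
  with xu have a: "- (l * \<delta> / 4) \<le> a" by simp
  have "y - x = (u - x) - l *\<^sub>R (y - z)" by (simp add: u_def)
  then have "blinfun_apply \<phi> (y - x) = a - l * p"
    by (simp only: a_def p_def blinfun.diff_right blinfun.scaleR_right) simp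
  with sub have sub': "?r x + a - l * p \<le> ?r y" by simp
  have "x - z = (1 + l) *\<^sub>R (y - z) - (u - x)" by (simp add: u_def algebra_simps)
  then have "blinfun_apply \<phi> (x - z) = (1 + l) * p - a"
    by (simp only: a_def p_def blinfun.diff_right blinfun.scaleR_right) simp
  with gap have gap': "(1 + l) * p - a \<le> ?r x - \<delta> + f z" by simp
  \<comment> \<open>The weights 1 + l and l make \<open>p\<close> cancel from the sum of the first
    two inequalities. The other two then give a < l \<delta> / 2 + l \<delta> / 4 - l \<delta> = - l
    \<delta> / 4, contrary to the lower bound on \<open>a\<close>; strictness comes from the choice
    of \<open>z\<close>.\<close>
  have "(1 + l) * (?r x + a - l * p) \<le> (1 + l) * ?r y"
    using sub' \<open>0 < l\<close> by (intro mult_left_mono) auto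
  moreover have "l * ((1 + l) * p - a) \<le> l * (?r x - \<delta> + f z)"
    using gap' \<open>0 < l\<close> by (intro mult_left_mono) auto
  moreover have "(1 + l) * (?r y - \<theta>) < (1 + l) * (norm (y - z) - f z)"
    using z \<open>0 < l\<close> by (intro mult_strict_left_mono) auto
  moreover have "(1 + l) * norm (y - z) - f z \<le> ?r x + l * \<delta> / 4"
  proof -
    have "u - z = (1 + l) *\<^sub>R (y - z)" by (simp add: u_def algebra_simps)
    then have "norm (u - z) = (1 + l) * norm (y - z)" using \<open>0 < l\<close> by simp
    moreover have "norm (u - z) - f z \<le> ?r u"
      using farthest_sup_upper[OF C(2,3) \<open>z \<in> C\<close>] .
    moreover have "?r u \<le> ?r x + norm (u - x)"
      using lipschitz_on_normD[OF lipschitz_farthest_sup[OF C], of u x] by simp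
    ultimately show ?thesis using xu by linarith
  qed
  ultimately show False
    using a \<theta> by (simp add: algebra_simps)
qed

text \<open>A single subgradient \<phi> is tested against all \<open>n\<close>. The point
  \<open>z\<close> that minimizes \<phi> + f on \<open>C\<close> maximizes \<phi> (x - z) - f z and
  does not depend on \<open>n\<close>, so the tolerance can tend to 0 with \<open>z\<close>
  fixed.\<close>

lemma farthest_attained_if_no_subgradient_gap:
  fixes C :: "'a::real_normed_vector set"
  assumes C: "C \<noteq> {}" "compactin weak_topology C" "bdd_below (f ` C)"
    and f: "lower_semicontinuous_map weak_topology f"
    and x: "\<And>n. x \<notin> subgradient_gap C f (1 / real (Suc n))"
  shows "x \<in> farthest_attained C f"
proof -
  let ?r = "farthest_sup C f"
  have bdd: "bounded C" using C(2) by (rule weakly_compact_imp_bounded)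
  obtain \<phi> :: "'a \<Rightarrow>\<^sub>L real" where "norm \<phi> \<le> 1"
    and sub: "\<And>y. ?r x + blinfun_apply \<phi> (y - x) \<le> ?r y"
    using convex_lipschitz_subgradient[OF convex_farthest_sup lipschitz_farthest_sup] C(1,3) bdd
    by metis
  have "lower_semicontinuous_map weak_topology (\<lambda>z. blinfun_apply \<phi> z + f z)"
    by (rule lower_semicontinuous_map_add_continuous_map[OF f continuous_map_weak_topology_blinfun])
  then obtain z where "z \<in> C"
    and z: "\<And>w. w \<in> C \<Longrightarrow> blinfun_apply \<phi> z + f z \<le> blinfun_apply \<phi> w + f w"
    using lower_semicontinuous_map_attains_min C(1,2) by blast
  have gap: "?r x - 1 / real (Suc n) \<le> blinfun_apply \<phi> (x - z) - f z" for n
  proof -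
    obtain w where "w \<in> C" "?r x - 1 / real (Suc n) < blinfun_apply \<phi> (x - w) - f w"
      using x[of n] \<open>norm \<phi> \<le> 1\<close> sub unfolding subgradient_gap_def by (force simp: not_le)
    with z[OF \<open>w \<in> C\<close>] show ?thesis
      by (simp add: blinfun.diff_right)
  qed
  have "?r x \<le> blinfun_apply \<phi> (x - z) - f z"
  proof (rule field_le_epsilon)
    fix e :: real assume "0 < e"
    then obtain n where "1 / real (Suc n) < e"
      using nat_approx_posE by blast
    with gap[of n] show "?r x \<le> blinfun_apply \<phi> (x - z) - f z + e" by linarith
  qed
  also have "\<dots> \<le> norm (x - z) - f z"
    using norm_blinfun[of \<phi> "x - z"] mult_right_mono[OF \<open>norm \<phi> \<le> 1\<close>, of "norm (x - z)"] by simp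
  finally have "?r x = norm (x - z) - f z"
    using farthest_sup_upper[OF bdd C(3) \<open>z \<in> C\<close>, of x] by simp
  with \<open>z \<in> C\<close> show ?thesis
    by (auto simp: farthest_attained_def)
qed

theorem theorem2p1:
  fixes C :: "'a::banach set" and f :: "'a \<Rightarrow> real"
  assumes "C \<noteq> {}"
    and "compactin weak_topology C"
    and "bdd_below (f ` C)"
    and "lower_semicontinuous_map weak_topology f"
  shows "\<exists>G. G \<subseteq> farthest_attained C f \<and> gdelta_in euclidean G \<and> closure G = UNIV"
proof -
  \<comment> \<open>Taking closures before complements makes each \<open>V n\<close> open, hence the
    intersection a G-delta set; nowhere density keeps each \<open>V n\<close> dense.\<close>
  define V where "V = (\<lambda>n. - closure (subgradient_gap C f (1 / real (Suc n))))"
  have V: "open (V n)" "closure (V n) = UNIV" for n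
    using nowhere_dense_subgradient_gap[OF assms(1) weakly_compact_imp_bounded[OF assms(2)] assms(3),
        of "1 / real (Suc n)"]
    by (simp_all add: V_def closure_complement open_Compl)
  have "closure (\<Inter>(range V)) = UNIV"
    using Baire_category[of "euclidean :: 'a topology" "range V"]
      completely_metrizable_space_euclidean V by auto
  moreover have "gdelta_in euclidean (\<Inter>(range V))"
    using V by (intro gdelta_in_Inter) (auto intro: open_imp_gdelta_in)
  moreover have "\<Inter>(range V) \<subseteq> farthest_attained C f"
  proof
    fix x assume "x \<in> \<Inter>(range V)"
    then have "x \<notin> subgradient_gap C f (1 / real (Suc n))" for n
      using closure_subset by (fastforce simp: V_def)
    then show "x \<in> farthest_attained C f"
      using farthest_attained_if_no_subgradient_gap assms by blast
  qed
  ultimately show ?thesis by blast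
qed

end
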